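(* Let $M_6$ be the Turing machine with states $A,B,C,D,E$ (plus halting state $H$) and symbols $b,0,1,2$ defined in the context. The $3x+1$ conjecture is true if and only if $M_6$ halts on every input $x_k\ldots x_0$ representing a positive integer $x=\sum_{i=0}^k x_i3^i$ written in base 3 (that is, when started in the initial configuration ${}^\omega b(Ax_k)x_{k-1}\ldots x_0b^\omega$).
   Context: The $3x+1$ function $T$ on positive integers is $T(m)=m/2$ if $m$ is even and $T(m)=(3m+1)/2$ if $m$ is odd. The $3x+1$ conjecture is the assertion that, when $T$ is iterated from any positive integer, the loop $2\mapsto 1\mapsto 2$ is always reached (i.e. for every positive integer $m$ some iterate $T^j(m)$, $j\ge 0$, lies in $\{1,2\}$; equivalently some iterate equals $1$). Turing machines have one tape, infinite on both sides, made of cells containing symbols, one read/write head, a set $Q$ of states plus a halting state $H$, a set $\Sigma$ of symbols containing a blank symbol $b$, and a next move function $\delta$. If $\delta(p,a)=(a',\Delta,q)$ then the machine, reading symbol $a$ in state $p$, replaces $a$ by $a'$, moves one cell in direction $\Delta\in\{L,R\}$ ($L$ = left, $R$ = right), and enters state $q$. The machine halts when it enters state $H$. The configuration ${}^\omega b(Ax_k)x_{k-1}\ldots x_0b^\omega$ is the one in which the word $x_k\ldots x_0$ is written on the tape between two infinite strings of blanks, the machine is in state $A$, and the head is on the symbol $x_k$. Base 3 representations are the usual ones, with $x_i\in\{0,1,2\}$, $x_k\neq 0$, most significant digit on the left. The machine $M_6$ has $Q=\{A,B,C,D,E\}$, $\Sigma=\{b,0,1,2\}$ (blank $b$), and the following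 transitions, where "$a'\Delta q$" in row $p$ and column $a$ means $\delta(p,a)=(a',\Delta,q)$; the pair $(D,b)$, not listed, has no transition defined (and reaching it does not count as halting): Row $A$: on $b$: $bLC$; on $0$: $0RA$; on $1$: $0RB$; on $2$: $1RA$. Row $B$: on $b$: $2LE$; on $0$: $1RB$; on $1$: $2RA$; on $2$: $2RB$. Row $C$: on $b$: $bRD$; on $0$: $0LC$; on $1$: $1LC$; on $2$: $2LC$. Row $D$: on $0$: $bRA$; on $1$: $bRB$; on $2$: $1RA$. Row $E$: on $b$: $bRH$; on $0$: $0LC$; on $1$: $1LC$; on $2$: $2LC$. *)

theory Defs
  imports Main
begin

definition collatz_T :: "nat \<Rightarrow> nat" where
  "collatz_T m = (if even m then m div 2 else (3 * m + 1) div 2)"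

definition collatz_conjecture :: bool where
  "collatz_conjecture \<longleftrightarrow> (\<forall>m>0. \<exists>j. (collatz_T ^^ j) m \<in> {1, 2})"

datatype direction = L | R

text \<open>The type \<open>'q\<close> contains the working states as well as the halting state.
  The value \<open>None\<close> means that no transition is defined.\<close>

type_synonym ('q, 's) next_move = "'q \<Rightarrow> 's \<Rightarrow> ('s \<times> direction \<times> 'q) option"

text \<open>Current state, tape contents, position of the head; cell \<open>i + 1\<close> is to the right
  of cell \<open>i\<close>.\<close>

datatype ('q, 's) config = Config 'q "int \<Rightarrow> 's" int

fun move :: "direction \<Rightarrow> int \<Rightarrow> int" where
  "move L i = i - 1"
| "move R i = i + 1"

inductive tm_step :: "('q, 's) next_move \<Rightarrow> ('q, 's) config \<Rightarrow> ('q, 's) config \<Rightarrow> bool"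
  for \<delta> where
  "\<delta> p (t i) = Some (a, d, q) \<Longrightarrow> tm_step \<delta> (Config p t i) (Config q (t(i := a)) (move d i))"

text \<open>Halting means entering the halting state \<open>h\<close>; getting stuck in another state for lack
  of a transition is not halting.\<close>

definition tm_halts :: "('q, 's) next_move \<Rightarrow> 'q \<Rightarrow> ('q, 's) config \<Rightarrow> bool" where
  "tm_halts \<delta> h c \<longleftrightarrow> (\<exists>t i. (tm_step \<delta>)\<^sup>*\<^sup>* c (Config h t i))"

text \<open>The word \<open>w\<close> between two infinite strings of the blank \<open>b\<close>, in state \<open>q\<close>, with the head
  on the first symbol of \<open>w\<close>.\<close>

definition initial_config :: "'q \<Rightarrow> 's \<Rightarrow> 's list \<Rightarrow> ('q, 's) config" where
  "initial_config q b w =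
     Config q (\<lambda>i. if 0 \<le> i \<and> i < int (length w) then w ! nat i else b) 0"

text \<open>The halting state of \<open>M6\<close> is \<open>H\<close>.\<close>

datatype state = A | B | C | D | E | H

datatype symbol = Blank | Zero | One | Two

fun M6 :: "(state, symbol) next_move" where
  "M6 A Blank = Some (Blank, L, C)"
| "M6 A Zero = Some (Zero, R, A)"
| "M6 A One = Some (Zero, R, B)"
| "M6 A Two = Some (One, R, A)"
| "M6 B Blank = Some (Two, L, E)"
| "M6 B Zero = Some (One, R, B)"
| "M6 B One = Some (Two, R, A)"
| "M6 B Two = Some (Two, R, B)"
| "M6 C Blank = Some (Blank, R, D)"
| "M6 C Zero = Some (Zero, L, C)"
| "M6 C One = Some (One, L, C)"
| "M6 C Two = Some (Two, L, C)"
| "M6 D Blank = None"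
| "M6 D Zero = Some (Blank, R, A)"
| "M6 D One = Some (Blank, R, B)"
| "M6 D Two = Some (One, R, A)"
| "M6 E Blank = Some (Blank, R, H)"
| "M6 E Zero = Some (Zero, L, C)"
| "M6 E One = Some (One, L, C)"
| "M6 E Two = Some (Two, L, C)"
| "M6 H _ = None"

text \<open>The list \<open>[x\<^sub>k, \<dots>, x\<^sub>0]\<close>, most significant digit first, represents \<open>x\<close>.\<close>

definition base3_rep :: "nat list \<Rightarrow> nat \<Rightarrow> bool" where
  "base3_rep xs x \<longleftrightarrow>
     xs \<noteq> [] \<and> set xs \<subseteq> {0, 1, 2} \<and> hd xs \<noteq> 0 \<and>
     x = (\<Sum>i<length xs. rev xs ! i * 3 ^ i)"

text \<open>Only meant for \<open>d \<in> {0, 1, 2}\<close>.\<close>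

definition digit_symbol :: "nat \<Rightarrow> symbol" where
  "digit_symbol d = (if d = 0 then Zero else if d = 1 then One else Two)"

end

theory Submission
  imports Defs
begin

text \<open>A rightward sweep of \<^const>\<open>M6\<close> is long division by \<open>2\<close> of a base \<open>3\<close> numeral: the states
  \<^const>\<open>A\<close> and \<^const>\<open>B\<close> hold the remainder \<open>0\<close> or \<open>1\<close>, and each digit is overwritten by a quotient
  digit. Let \<open>n\<close> be the number on the tape, and \<open>q\<close> its half rounded down. If the final remainder
  is \<open>0\<close>, the tape keeps \<open>q = n / 2\<close>; if it is \<open>1\<close>, the machine appends the digit \<open>2\<close> and obtains
  \<open>3 * q + 2 = (3 * n + 1) / 2\<close>. Thus one sweep computes \<^const>\<open>collatz_T\<close> (lemma
  \<open>sweep_and_return\<close>). The states \<^const>\<open>E\<close> and \<^const>\<open>C\<close> bring the head back to the left end,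
  where \<^const>\<open>D\<close> starts the next sweep; on digits it differs from \<^const>\<open>A\<close> only in erasing the cell where
  \<^const>\<open>A\<close> would write a leading \<open>0\<close>.

  Entering \<^const>\<open>H\<close> requires that \<^const>\<open>E\<close> sees a blank, so that the appended \<open>2\<close> is the only
  symbol left. This happens just when \<^const>\<open>D\<close> starts on the word \<open>1\<close>; from any other word of
  positive value the machine completes a sweep (lemma \<open>collatz_cycle\<close>). Since the machine is
  deterministic, halting therefore forces the orbit through \<open>1\<close> (lemma \<open>halts_imp_orbit\<close>).
  Conversely, when the orbit reaches \<open>1\<close> the tape holds \<open>0\<dots>01\<close>. Two sweeps, through the value
  \<open>2\<close>, remove one leading \<open>0\<close>, so that the word \<open>1\<close> is reached in the end
  (lemma \<open>halts_at_one\<close>).\<close>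

section \<open>Base 3 words and their halves\<close>

text \<open>The accumulator \<open>a\<close> is the value of the digits already read. Carrying it along makes the
  invariant of long division provable by induction from the most significant digit.\<close>

primrec horner :: "nat \<Rightarrow> nat list \<Rightarrow> nat" where
  "horner a [] = a"
| "horner a (d # ds) = horner (3 * a + d) ds"

lemma horner_append: "horner a (xs @ ys) = horner (horner a xs) ys"
  by (induction xs arbitrary: a) auto

abbreviation digits :: "nat list \<Rightarrow> bool" where
  "digits ds \<equiv> set ds \<subseteq> {0, 1, 2}"

primrec halve :: "nat \<Rightarrow> nat list \<Rightarrow> nat list" where
  "halve c [] = []"
| "halve c (d # ds) = (3 * c + d) div 2 # halve ((3 * c + d) mod 2) ds"

primrec remainder :: "nat \<Rightarrow> nat list \<Rightarrow> nat" where
  "remainder c [] = c"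
| "remainder c (d # ds) = remainder ((3 * c + d) mod 2) ds"

lemma remainder_less: "c < 2 \<Longrightarrow> remainder c ds < 2"
  by (induction ds arbitrary: c) auto

lemma digits_halve: "c < 2 \<Longrightarrow> digits ds \<Longrightarrow> digits (halve c ds)"
proof (induction ds arbitrary: c)
  case (Cons d ds)
  have "(3 * c + d) div 2 \<in> {0, 1, 2}" using Cons.prems by (auto simp: less_2_cases_iff)
  then show ?case using Cons by simp
qed simp

text \<open>At each point the number read so far is twice the quotient written so far, plus the
  remainder held in the state.\<close>

lemma horner_halve: "horner (2 * a + c) ds = 2 * horner a (halve c ds) + remainder c ds"
proof (induction ds arbitrary: a c)
  case (Cons d ds)
  have "3 * (2 * a + c) + d = 2 * (3 * a + (3 * c + d) div 2) + (3 * c + d) mod 2"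
    by simp
  then show ?case using Cons.IH by (simp only: horner.simps halve.simps remainder.simps)
qed simp

lemma halve_leading_zeros: "halve 0 (replicate k 0 @ ds) = replicate k 0 @ halve 0 ds"
  by (induction k) auto

lemma remainder_leading_zeros: "remainder 0 (replicate k 0 @ ds) = remainder 0 ds"
  by (induction k) auto

lemma horner_eq_0:
  assumes "horner 0 ds = 0"
  shows "ds = replicate (length ds) 0"
proof (rule replicate_eqI)
  show "d = 0" if "d \<in> set ds" for d
    using assms that by (induction ds rule: rev_induct) (auto simp: horner_append)
qed simp

lemma horner_eq_1:
  assumes "horner 0 ds = 1"
  obtains k where "ds = replicate k 0 @ [1]"
proof (cases ds rule: rev_cases)
  case (snoc ds' d)
  with assms have "3 * horner 0 ds' + d = 1" by (simp add: horner_append)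
  then have "horner 0 ds' = 0" "d = 1" by presburger+
  with snoc horner_eq_0 that show thesis by metis
qed (use assms in simp)

lemma horner_eq_sum: "horner 0 xs = (\<Sum>i<length xs. rev xs ! i * 3 ^ i)"
proof (induction xs rule: rev_induct)
  case (snoc x xs)
  then show ?case
    by (simp add: horner_append sum.lessThan_Suc_shift sum_distrib_left mult_ac del: sum.lessThan_Suc)
qed simp

lemma base3_rep_exists: "x > 0 \<Longrightarrow> \<exists>xs. base3_rep xs x"
proof (induction x rule: less_induct)
  case (less x)
  show ?case
  proof (cases "x < 3")
    case True
    then have "x \<in> {0, 1, 2}" by auto
    with less.prems have "base3_rep [x] x" by (simp add: base3_rep_def)
    then show ?thesis ..
  next
    case False
    then obtain xs where "base3_rep xs (x div 3)"
      using less.IH[of "x div 3"] by (auto simp: div_greater_zero_iff)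
    moreover have "x mod 3 \<in> {0, 1, 2}" by auto
    ultimately have "base3_rep (xs @ [x mod 3]) x"
      unfolding base3_rep_def horner_eq_sum[symmetric]
      using mult_div_mod_eq[of 3 x] by (auto simp: horner_append)
    then show ?thesis ..
  qed
qed

section \<open>Tapes with finitely many nonblank cells\<close>

definition cell :: "symbol list \<Rightarrow> nat \<Rightarrow> symbol" where
  "cell w n = (if n < length w then w ! n else Blank)"

text \<open>A zipper view of a configuration: \<open>r\<close> is read rightwards from the head, which is at
  position \<open>p\<close>, and \<open>l\<close> is read leftwards from the cell to the left of the head. Every move
  then only takes a symbol from the front of one list and puts one at the front of the other.\<close>

definition scan :: "state \<Rightarrow> int \<Rightarrow> symbol list \<Rightarrow> symbol list \<Rightarrow> (state, symbol) config" where
  "scan q p l r =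
     Config q (\<lambda>j. if j < p then cell l (nat (p - 1 - j)) else cell r (nat (j - p))) p"

lemma cell_Cons: "cell (a # w) n = (if n = 0 then a else cell w (n - 1))"
  by (cases n) (auto simp: cell_def)

lemma cell_append_Blank: "cell (w @ [Blank]) = cell w"
  by (auto simp: cell_def nth_append fun_eq_iff)

lemma scan_right_Blank: "scan q p l (r @ [Blank]) = scan q p l r"
  unfolding scan_def cell_append_Blank ..

lemma scan_left_Blank: "scan q p [Blank] r = scan q p [] r"
  unfolding scan_def cell_append_Blank[of "[]", simplified] ..

lemma initial_config_scan: "initial_config q Blank w = scan q 0 [] w"
  by (auto simp: initial_config_def scan_def cell_def fun_eq_iff)

lemma step_right:
  assumes "M6 q a = Some (a', R, q')"
  shows "tm_step M6 (scan q p l (a # r)) (scan q' (p + 1) (a' # l) r)"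
proof -
  let ?t = "\<lambda>j. if j < p then cell l (nat (p - 1 - j)) else cell (a # r) (nat (j - p))"
  have "M6 q (?t p) = Some (a', R, q')" using assms by (simp add: cell_Cons)
  from tm_step.intros[of M6 q ?t p, OF this]
  have "tm_step M6 (scan q p l (a # r)) (Config q' (?t(p := a')) (p + 1))"
    by (simp add: scan_def)
  also have "Config q' (?t(p := a')) (p + 1) = scan q' (p + 1) (a' # l) r"
    by (auto simp: scan_def cell_Cons fun_eq_iff nat_diff_distrib' intro!: arg_cong[of _ _ "cell _"])
  finally show ?thesis .
qed

lemma step_left:
  assumes "M6 q a = Some (a', L, q')"
  shows "tm_step M6 (scan q p (c # l) (a # r)) (scan q' (p - 1) l (c # a' # r))"
proof -
  let ?t = "\<lambda>j. if j < p then cell (c # l) (nat (p - 1 - j)) else cell (a # r) (nat (j - p))"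
  have "M6 q (?t p) = Some (a', L, q')" using assms by (simp add: cell_Cons)
  from tm_step.intros[of M6 q ?t p, OF this]
  have "tm_step M6 (scan q p (c # l) (a # r)) (Config q' (?t(p := a')) (p - 1))"
    by (simp add: scan_def)
  also have "Config q' (?t(p := a')) (p - 1) = scan q' (p - 1) l (c # a' # r)"
    by (auto simp: scan_def cell_Cons fun_eq_iff intro!: arg_cong[of _ _ "cell _"])
  finally show ?thesis .
qed

lemma step_left_edge:
  assumes "M6 q a = Some (a', L, q')"
  shows "tm_step M6 (scan q p [] (a # r)) (scan q' (p - 1) [] (Blank # a' # r))"
  using step_left[OF assms, of p Blank "[]" r] by (simp add: scan_left_Blank)

section \<open>One sweep computes the Collatz map\<close>

abbreviation word :: "nat list \<Rightarrow> symbol list" where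
  "word \<equiv> map digit_symbol"

lemma digit_symbol_simps [simp]:
  "digit_symbol 0 = Zero" "digit_symbol (Suc 0) = One" "digit_symbol 2 = Two"
  by (simp_all add: digit_symbol_def)

lemma digit_symbol_not_Blank: "digit_symbol d \<noteq> Blank"
  by (simp add: digit_symbol_def)

definition remainder_state :: "nat \<Rightarrow> state" where
  "remainder_state c = (if c = 0 then A else B)"

lemma M6_division:
  assumes "c < 2" "d \<in> {0, 1, 2}"
  shows "M6 (remainder_state c) (digit_symbol d) =
    Some (digit_symbol ((3 * c + d) div 2), R, remainder_state ((3 * c + d) mod 2))"
proof -
  have "c = 0 \<or> c = 1" "d = 0 \<or> d = 1 \<or> d = 2" using assms by auto
  then show ?thesis by (elim disjE) (simp_all add: remainder_state_def digit_symbol_def)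
qed

lemma sweep:
  assumes "c < 2" "digits ds"
  shows "\<exists>p'. (tm_step M6)\<^sup>*\<^sup>* (scan (remainder_state c) p l (word ds))
    (scan (remainder_state (remainder c ds)) p' (rev (word (halve c ds)) @ l) [])"
  using assms
proof (induction ds arbitrary: c p l)
  case (Cons d ds)
  let ?s = "3 * c + d"
  have "?s mod 2 < 2" "digits ds" using Cons.prems(2) by auto
  from Cons.IH[OF this, of "p + 1" "digit_symbol (?s div 2) # l"]
  obtain p' where "(tm_step M6)\<^sup>*\<^sup>*
    (scan (remainder_state (?s mod 2)) (p + 1) (digit_symbol (?s div 2) # l) (word ds))
    (scan (remainder_state (remainder (?s mod 2) ds)) p'
       (rev (word (halve (?s mod 2) ds)) @ digit_symbol (?s div 2) # l) [])"
    by blast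
  moreover have "tm_step M6 (scan (remainder_state c) p l (word (d # ds)))
    (scan (remainder_state (?s mod 2)) (p + 1) (digit_symbol (?s div 2) # l) (word ds))"
    using step_right[OF M6_division] Cons.prems by simp
  ultimately have "(tm_step M6)\<^sup>*\<^sup>* (scan (remainder_state c) p l (word (d # ds)))
    (scan (remainder_state (remainder (?s mod 2) ds)) p'
       (rev (word (halve (?s mod 2) ds)) @ digit_symbol (?s div 2) # l) [])"
    by (metis converse_rtranclp_into_rtranclp)
  then show ?case by auto
qed auto

text \<open>On nonblank symbols \<^const>\<open>E\<close> acts like \<^const>\<open>C\<close>, so both start the same return to the left
  end. The head has to start on a nonblank symbol: on a blank, \<^const>\<open>E\<close> halts.\<close>

lemma return_left:
  assumes "q = C \<or> q = E" "a \<noteq> Blank" "Blank \<notin> set l"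
  shows "\<exists>p'. (tm_step M6)\<^sup>*\<^sup>* (scan q p l (a # r)) (scan D p' [] (rev l @ a # r))"
  using assms
proof (induction l arbitrary: q p a r)
  case Nil
  have "M6 q a = Some (a, L, C)" using Nil by (cases a) auto
  from step_left_edge[OF this]
  have "tm_step M6 (scan q p [] (a # r)) (scan C (p - 1) [] (Blank # a # r))" .
  moreover have "tm_step M6 (scan C (p - 1) [] (Blank # a # r)) (scan D p [] (a # r))"
    using step_right[of C Blank Blank D "p - 1" "[]" "a # r"] by (simp add: scan_left_Blank)
  ultimately have "(tm_step M6)\<^sup>*\<^sup>* (scan q p [] (a # r)) (scan D p [] (a # r))"
    by (meson converse_rtranclp_into_rtranclp r_into_rtranclp)
  then show ?case by auto
next
  case (Cons c l)
  have "M6 q a = Some (a, L, C)" using Cons.prems by (cases a) auto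
  from step_left[OF this]
  have "tm_step M6 (scan q p (c # l) (a # r)) (scan C (p - 1) l (c # a # r))" .
  moreover obtain p' where
    "(tm_step M6)\<^sup>*\<^sup>* (scan C (p - 1) l (c # a # r)) (scan D p' [] (rev l @ c # a # r))"
    using Cons.IH[of C c "p - 1" "a # r"] Cons.prems by auto
  ultimately have "(tm_step M6)\<^sup>*\<^sup>* (scan q p (c # l) (a # r)) (scan D p' [] (rev l @ c # a # r))"
    by (rule converse_rtranclp_into_rtranclp)
  then show ?case by auto
qed

lemma turn_and_return:
  assumes "u \<noteq> []"
  shows "\<exists>p'. (tm_step M6)\<^sup>*\<^sup>* (scan (remainder_state c) p (rev (word u)) [])
    (scan D p' [] (word (u @ (if c = 0 then [] else [2]))))"
proof -
  obtain u' d where u: "u = u' @ [d]" using assms by (cases u rule: rev_cases) auto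
  have nb: "digit_symbol d \<noteq> Blank" "Blank \<notin> set (rev (word u'))"
    using digit_symbol_not_Blank by (auto, metis)
  define x where "x = (if c = 0 then Blank else Two)"
  define q where "q = (if c = 0 then C else E)"
  have q: "q = C \<or> q = E" by (simp add: q_def)
  have "M6 (remainder_state c) Blank = Some (x, L, q)"
    by (simp add: remainder_state_def x_def q_def)
  from step_left[OF this, of p "digit_symbol d" "rev (word u')" "[]"]
  have "tm_step M6 (scan (remainder_state c) p (rev (word u)) [])
      (scan q (p - 1) (rev (word u')) [digit_symbol d, x])"
    using scan_right_Blank[of _ _ _ "[]"] by (simp add: u)
  moreover obtain p' where
    "(tm_step M6)\<^sup>*\<^sup>* (scan q (p - 1) (rev (word u')) [digit_symbol d, x])
       (scan D p' [] (word u @ [x]))"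
    using return_left[OF q nb, of "p - 1" "[x]"] by (auto simp: u)
  moreover have "scan D p' [] (word u @ [x]) =
      scan D p' [] (word (u @ (if c = 0 then [] else [2])))"
    by (simp add: x_def scan_right_Blank)
  ultimately show ?thesis by (metis converse_rtranclp_into_rtranclp)
qed

text \<open>The parameter \<open>u\<close> is the part of the quotient already written: a sweep begun by \<^const>\<open>D\<close> on the digit
  \<open>2\<close> enters here with \<open>u = [1]\<close>, every other sweep with \<open>u = []\<close>.\<close>

lemma sweep_and_return_word:
  assumes "c < 2" "digits v" "u @ v \<noteq> []"
  shows "\<exists>p'. (tm_step M6)\<^sup>*\<^sup>* (scan (remainder_state c) p (rev (word u)) (word v))
    (scan D p' [] (word (u @ halve c v @ (if remainder c v = 0 then [] else [2]))))"
proof -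
  obtain p1 where "(tm_step M6)\<^sup>*\<^sup>* (scan (remainder_state c) p (rev (word u)) (word v))
      (scan (remainder_state (remainder c v)) p1 (rev (word (u @ halve c v))) [])"
    using sweep[OF assms(1,2), of p "rev (word u)"] by auto
  moreover have "u @ halve c v \<noteq> []" using assms(3) by (cases v) auto
  from turn_and_return[OF this] obtain p2 where
    "(tm_step M6)\<^sup>*\<^sup>*
      (scan (remainder_state (remainder c v)) p1 (rev (word (u @ halve c v))) [])
      (scan D p2 [] (word ((u @ halve c v) @ (if remainder c v = 0 then [] else [2]))))"
    by blast
  ultimately show ?thesis unfolding append_assoc by (meson rtranclp_trans)
qed

lemma sweep_and_return:
  assumes "c < 2" "digits u" "digits v" "u @ v \<noteq> []"
    and n: "n = horner (2 * horner 0 u + c) v"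
  shows "\<exists>p' ws. (tm_step M6)\<^sup>*\<^sup>* (scan (remainder_state c) p (rev (word u)) (word v))
    (scan D p' [] (word ws)) \<and> digits ws \<and> horner 0 ws = collatz_T n"
proof -
  define ws where "ws = u @ halve c v @ (if remainder c v = 0 then [] else [2])"
  obtain p' where run: "(tm_step M6)\<^sup>*\<^sup>*
      (scan (remainder_state c) p (rev (word u)) (word v)) (scan D p' [] (word ws))"
    unfolding ws_def using sweep_and_return_word[OF assms(1,3,4)] ..
  have "digits ws"
    using assms(2) digits_halve[OF assms(1,3)] by (simp add: ws_def)
  moreover have "horner 0 ws = collatz_T n"
  proof -
    define q where "q = horner (horner 0 u) (halve c v)"
    have "n = 2 * q + remainder c v" by (simp only: n q_def horner_halve)
    moreover have "horner 0 ws = (if remainder c v = 0 then q else 3 * q + 2)"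
      by (simp add: ws_def q_def horner_append)
    ultimately show ?thesis
      using remainder_less[OF assms(1), of v] by (auto simp: collatz_T_def less_2_cases_iff)
  qed
  ultimately show ?thesis using run by (intro exI conjI)
qed

text \<open>A step of \<^const>\<open>D\<close> only moves the work already done on the first digit into \<open>u\<close> and into the
  remainder. The word \<open>[1]\<close> is excluded because it leaves nothing on the tape to return over;
  positivity does the same for the word \<open>[0]\<close>, on which the machine gets stuck.\<close>

lemma collatz_cycle:
  assumes "digits ws" "horner 0 ws > 0" "ws \<noteq> [1]"
  shows "\<exists>p' ws'. (tm_step M6)\<^sup>+\<^sup>+ (scan D p [] (word ws)) (scan D p' [] (word ws')) \<and>
    digits ws' \<and> horner 0 ws' = collatz_T (horner 0 ws)"
proof -
  obtain d v where ws: "ws = d # v" using assms(2) by (cases ws) auto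
  \<comment> \<open>The quotient of the first digit by \<open>2\<close> is kept only when it is not \<open>0\<close>.\<close>
  define u where "u = (if d = 2 then [1] else [] :: nat list)"
  define c where "c = (if d = 1 then 1 else 0 :: nat)"
  have d: "d \<in> {0, 1, 2}" and v: "digits v" using assms(1) ws by auto
  have "u @ v \<noteq> []" using assms(2,3) d by (auto simp: ws u_def)
  moreover have "horner 0 ws = horner (2 * horner 0 u + c) v"
    using d by (auto simp: ws u_def c_def)
  moreover have "c < 2" "digits u" by (auto simp: c_def u_def)
  ultimately obtain p' ws' where
    "(tm_step M6)\<^sup>*\<^sup>* (scan (remainder_state c) (p + 1) (rev (word u)) (word v))
       (scan D p' [] (word ws'))" "digits ws'" "horner 0 ws' = collatz_T (horner 0 ws)"
    using sweep_and_return[of c u v "horner 0 ws" "p + 1"] v by blast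
  moreover have "tm_step M6 (scan D p [] (word ws))
      (scan (remainder_state c) (p + 1) (rev (word u)) (word v))"
  proof -
    have "M6 D (digit_symbol d) =
        Some (if d = 2 then One else Blank, R, remainder_state c)"
      using d by (auto simp: c_def remainder_state_def)
    from step_right[OF this, of p "[]" "word v"] show ?thesis
      by (simp add: ws u_def scan_left_Blank split: if_splits)
  qed
  ultimately show ?thesis by (meson rtranclp_into_tranclp2)
qed

section \<open>Halting\<close>

lemma tm_halts_back: "(tm_step \<delta>)\<^sup>*\<^sup>* c c' \<Longrightarrow> tm_halts \<delta> h c' \<Longrightarrow> tm_halts \<delta> h c"
  unfolding tm_halts_def by (meson rtranclp_trans)

lemma halts_on_word_1: "tm_halts M6 H (scan D p [] [One])"
proof -
  have "tm_step M6 (scan D p [] [One]) (scan B (p + 1) [] [Blank])"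
    using step_right[of D One Blank B p "[]" "[]"] scan_right_Blank[of B "p + 1" "[]" "[]"]
    by (simp add: scan_left_Blank)
  moreover have "tm_step M6 (scan B (p + 1) [] [Blank]) (scan E p [] [Blank, Two])"
    using step_left_edge[of B Blank Two E "p + 1" "[]"] by simp
  moreover have "tm_step M6 (scan E p [] [Blank, Two]) (scan H (p + 1) [Blank] [Two])"
    using step_right[of E Blank Blank H p "[]" "[Two]"] by simp
  ultimately have "(tm_step M6)\<^sup>*\<^sup>* (scan D p [] [One]) (scan H (p + 1) [Blank] [Two])"
    by (meson converse_rtranclp_into_rtranclp r_into_rtranclp)
  then show ?thesis unfolding tm_halts_def scan_def[of H] by blast
qed

text \<open>As long as there is a leading \<open>0\<close>, the value \<open>1\<close> does not stop the machine, which
  goes round the loop \<open>1, 2, 1\<close>. The first sweep replaces the digit \<open>1\<close> by \<open>0\<close> and appends \<open>2\<close>, while \<^const>\<open>D\<close> erases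
  one \<open>0\<close>; the second sweep turns \<open>2\<close> into \<open>1\<close> and erases another \<open>0\<close>.\<close>

lemma halts_at_one: "tm_halts M6 H (scan D p [] (word (replicate k 0 @ [1])))"
proof (induction k arbitrary: p)
  case 0
  then show ?case using halts_on_word_1 by simp
next
  case (Suc k)
  have drop_zero: "\<exists>p'. (tm_step M6)\<^sup>*\<^sup>* (scan D p [] (word (0 # v))) (scan D p' []
      (word (halve 0 v @ (if remainder 0 v = 0 then [] else [2]))))"
    if "digits v" "v \<noteq> []" for p v
  proof -
    have "tm_step M6 (scan D p [] (word (0 # v))) (scan A (p + 1) [] (word v))"
      using step_right[of D Zero Blank A p "[]" "word v"] by (simp add: scan_left_Blank)
    moreover have "[] @ v \<noteq> []" using that(2) by simp
    from sweep_and_return_word[OF _ that(1) this, of 0 "p + 1"]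
    obtain p' where "(tm_step M6)\<^sup>*\<^sup>* (scan A (p + 1) [] (word v)) (scan D p' []
        (word (halve 0 v @ (if remainder 0 v = 0 then [] else [2]))))"
      by (auto simp: remainder_state_def)
    ultimately show ?thesis by (meson converse_rtranclp_into_rtranclp)
  qed
  define halved where "halved v = halve 0 v @ (if remainder 0 v = 0 then [] else [2])" for v
  have "halved (replicate k 0 @ [1]) = replicate k 0 @ [0, 2]"
    by (simp add: halved_def halve_leading_zeros remainder_leading_zeros)
  moreover have "halved (replicate k 0 @ [2]) = replicate k 0 @ [1]"
    by (simp add: halved_def halve_leading_zeros remainder_leading_zeros)
  moreover have "replicate k 0 @ [0, 2] = 0 # replicate k 0 @ [2::nat]"
    by (simp add: replicate_app_Cons_same)
  moreover have "digits (replicate k 0 @ [1])" "digits (replicate k 0 @ [2])" by auto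
  ultimately obtain p1 p2 where
    "(tm_step M6)\<^sup>*\<^sup>* (scan D p [] (word (0 # replicate k 0 @ [1])))
      (scan D p1 [] (word (0 # replicate k 0 @ [2])))"
    "(tm_step M6)\<^sup>*\<^sup>* (scan D p1 [] (word (0 # replicate k 0 @ [2])))
      (scan D p2 [] (word (replicate k 0 @ [1])))"
    using drop_zero[folded halved_def] by (metis append_is_Nil_conv not_Cons_self2)
  then have "tm_halts M6 H (scan D p [] (word (0 # replicate k 0 @ [1])))"
    using tm_halts_back Suc by meson
  then show ?case by simp
qed

lemma collatz_T_pos: "n > 0 \<Longrightarrow> collatz_T n > 0"
  by (auto simp: collatz_T_def)

lemma orbit_imp_halts:
  assumes "(collatz_T ^^ j) (horner 0 ws) = 1" "digits ws" "horner 0 ws > 0"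
  shows "tm_halts M6 H (scan D p [] (word ws))"
  using assms
proof (induction j arbitrary: ws p)
  case 0
  then have "horner 0 ws = 1" by simp
  then obtain k where "ws = replicate k 0 @ [1]" by (rule horner_eq_1)
  then show ?case using halts_at_one by simp
next
  case (Suc j)
  show ?case
  proof (cases "ws = [1]")
    case True
    then show ?thesis using halts_on_word_1 by simp
  next
    case False
    with collatz_cycle Suc.prems obtain p' ws' where
      "(tm_step M6)\<^sup>+\<^sup>+ (scan D p [] (word ws)) (scan D p' [] (word ws'))"
      "digits ws'" and ws': "horner 0 ws' = collatz_T (horner 0 ws)"
      by blast
    moreover have "tm_halts M6 H (scan D p' [] (word ws'))"
      using Suc collatz_T_pos \<open>digits ws'\<close> ws' by (simp add: funpow_swap1)
    ultimately show ?thesis using tm_halts_back tranclp_into_rtranclp by metis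
  qed
qed

lemma tm_step_deterministic: "tm_step \<delta> c c1 \<Longrightarrow> tm_step \<delta> c c2 \<Longrightarrow> c1 = c2"
  by (erule tm_step.cases, erule tm_step.cases) simp

text \<open>By determinism any configuration reached on the way lies on the unique path to the final one,
  so it is closer to halting. This makes the number of steps a measure for induction over
  whole sweeps.\<close>

lemma remaining_steps:
  assumes "\<And>y'. \<not> tm_step \<delta> y y'" "(tm_step \<delta> ^^ n) x y" "(tm_step \<delta> ^^ k) x z"
  shows "k \<le> n \<and> (tm_step \<delta> ^^ (n - k)) z y"
  using assms(2,3)
proof (induction k arbitrary: n x)
  case (Suc k)
  from relpowp_Suc_D2[OF Suc.prems(2)]
  obtain x' where x': "tm_step \<delta> x x'" "(tm_step \<delta> ^^ k) x' z" by blast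
  then obtain m where m: "n = Suc m" using Suc.prems(1) assms(1) by (cases n) auto
  from relpowp_Suc_D2[OF Suc.prems(1)[unfolded m]]
  obtain x'' where "tm_step \<delta> x x''" "(tm_step \<delta> ^^ m) x'' y" by blast
  with tm_step_deterministic[OF x'(1)] have "(tm_step \<delta> ^^ m) x' y" by blast
  from Suc.IH[OF this x'(2)] m show ?case by simp
qed auto

lemma M6_no_step_from_H: "\<not> tm_step M6 (Config H t i) c"
  by (rule notI, erule tm_step.cases) simp

lemma halts_imp_orbit:
  assumes "tm_halts M6 H (scan D p [] (word ws))" "digits ws" "horner 0 ws > 0"
  shows "\<exists>j. (collatz_T ^^ j) (horner 0 ws) = 1"
proof -
  obtain t i n where "(tm_step M6 ^^ n) (scan D p [] (word ws)) (Config H t i)"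
    using assms(1) unfolding tm_halts_def by (meson rtranclp_imp_relpowp)
  then show ?thesis using assms(2,3)
  proof (induction n arbitrary: ws p rule: less_induct)
    case (less n)
    show ?case
    proof (cases "ws = [1]")
      case True
      then show ?thesis by (auto intro: exI[of _ 0])
    next
      case False
      with collatz_cycle less.prems obtain p' ws' where
        cyc: "(tm_step M6)\<^sup>+\<^sup>+ (scan D p [] (word ws)) (scan D p' [] (word ws'))"
        and ws': "digits ws'" "horner 0 ws' = collatz_T (horner 0 ws)"
        by blast
      from cyc obtain k where k: "k > 0"
        "(tm_step M6 ^^ k) (scan D p [] (word ws)) (scan D p' [] (word ws'))"
        unfolding tranclp_power by blast
      from remaining_steps[OF M6_no_step_from_H less.prems(1) k(2)]
      have "n - k < n" "(tm_step M6 ^^ (n - k)) (scan D p' [] (word ws')) (Config H t i)"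
        using k(1) by auto
      from less.IH[OF this ws'(1)]
      obtain j where "(collatz_T ^^ j) (collatz_T (horner 0 ws)) = 1"
        using ws'(2) less.prems(3) collatz_T_pos by auto
      then have "(collatz_T ^^ Suc j) (horner 0 ws) = 1" by (simp add: funpow_swap1)
      then show ?thesis ..
    qed
  qed
qed

section \<open>The equivalence\<close>

lemma collatz_conjecture_iff_1:
  "collatz_conjecture \<longleftrightarrow> (\<forall>m>0. \<exists>j. (collatz_T ^^ j) m = 1)"
proof -
  have "\<exists>j. (collatz_T ^^ j) m = 1" if "(collatz_T ^^ j) m \<in> {1, 2}" for j m
  proof (cases "(collatz_T ^^ j) m = 1")
    case False
    with that have "(collatz_T ^^ Suc j) m = 1" by (simp add: collatz_T_def)
    then show ?thesis ..
  qed auto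
  then show ?thesis unfolding collatz_conjecture_def by blast
qed

text \<open>The first sweep starts in \<^const>\<open>A\<close>, so the words on which \<^const>\<open>D\<close> starts have the values
  of the orbit of \<open>x\<close> from \<open>collatz_T x\<close> on.\<close>

lemma tm_halts_iff_orbit:
  assumes "base3_rep xs x" "x > 0"
  shows "tm_halts M6 H (initial_config A Blank (word xs)) \<longleftrightarrow>
    (\<exists>j. (collatz_T ^^ j) (collatz_T x) = 1)"
proof -
  have "digits xs" "xs \<noteq> []" "x = horner 0 xs"
    using assms(1) unfolding base3_rep_def horner_eq_sum by auto
  then obtain p ws where run:
    "(tm_step M6)\<^sup>*\<^sup>* (initial_config A Blank (word xs)) (scan D p [] (word ws))"
    and ws: "digits ws" "horner 0 ws = collatz_T x"
    using sweep_and_return[of 0 "[]" xs x 0]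
    by (auto simp: initial_config_scan remainder_state_def)
  have "tm_halts M6 H (scan D p [] (word ws))"
    if "tm_halts M6 H (initial_config A Blank (word xs))"
  proof -
    from that obtain t i n where
      "(tm_step M6 ^^ n) (initial_config A Blank (word xs)) (Config H t i)"
      unfolding tm_halts_def by (meson rtranclp_imp_relpowp)
    moreover obtain k where
      "(tm_step M6 ^^ k) (initial_config A Blank (word xs)) (scan D p [] (word ws))"
      using run by (meson rtranclp_imp_relpowp)
    ultimately have "(tm_step M6 ^^ (n - k)) (scan D p [] (word ws)) (Config H t i)"
      using remaining_steps[OF M6_no_step_from_H] by blast
    then show ?thesis unfolding tm_halts_def by (meson relpowp_imp_rtranclp)
  qed
  then have "tm_halts M6 H (initial_config A Blank (word xs)) \<longleftrightarrow>
      tm_halts M6 H (scan D p [] (word ws))"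
    using tm_halts_back[OF run] by (rule iffI)
  also have "\<dots> \<longleftrightarrow> (\<exists>j. (collatz_T ^^ j) (collatz_T x) = 1)"
  proof -
    have pos: "horner 0 ws > 0" using ws(2) collatz_T_pos[OF assms(2)] by simp
    show ?thesis
      using orbit_imp_halts[OF _ ws(1) pos, of _ p] halts_imp_orbit[OF _ ws(1) pos, of p]
      unfolding ws(2) by blast
  qed
  finally show ?thesis .
qed

theorem theorem5p3:
  "collatz_conjecture \<longleftrightarrow>
     (\<forall>x>0. \<forall>xs. base3_rep xs x \<longrightarrow>
        tm_halts M6 H (initial_config A Blank (map digit_symbol xs)))"
proof
  assume conj: "collatz_conjecture"
  show "\<forall>x>0. \<forall>xs. base3_rep xs x \<longrightarrow>
      tm_halts M6 H (initial_config A Blank (map digit_symbol xs))"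
  proof (intro allI impI)
    fix x xs
    assume "x > 0" "base3_rep xs x"
    moreover have "\<exists>j. (collatz_T ^^ j) (collatz_T x) = 1"
      using conj collatz_T_pos[OF \<open>x > 0\<close>] unfolding collatz_conjecture_iff_1 by simp
    ultimately show "tm_halts M6 H (initial_config A Blank (map digit_symbol xs))"
      using tm_halts_iff_orbit by simp
  qed
next
  assume halts: "\<forall>x>0. \<forall>xs. base3_rep xs x \<longrightarrow>
      tm_halts M6 H (initial_config A Blank (map digit_symbol xs))"
  have "\<exists>j. (collatz_T ^^ j) x = 1" if pos: "x > 0" for x
  proof -
    obtain xs where xs: "base3_rep xs x" using base3_rep_exists[OF pos] ..
    have "tm_halts M6 H (initial_config A Blank (map digit_symbol xs))"
      using halts[rule_format, OF pos xs] .
    then obtain j where "(collatz_T ^^ j) (collatz_T x) = 1"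
      unfolding tm_halts_iff_orbit[OF xs pos] ..
    then have "(collatz_T ^^ Suc j) x = 1" by (simp only: funpow_Suc_right o_apply)
    then show ?thesis ..
  qed
  then show "collatz_conjecture" unfolding collatz_conjecture_iff_1 by simp
qed

end
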